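(* For every graph $G$, $\mathrm{smw}(G)=\chi(G)$.
   Context: All graphs are finite, simple and undirected; $\chi(G)$ is the chromatic number. For vertices $u,v$ of a connected graph, $I(u,v)$ is the set of vertices on shortest $(u,v)$-paths; a vertex set $S$ is convex if $I(u,v)\subseteq S$ for all $u,v\in S$. A median graph is a connected graph $M$ with $|I(u,v)\cap I(v,w)\cap I(w,u)|=1$ for all vertices $u,v,w$. A median decomposition of $G$ is a pair $(M,\mathcal{X})$ with $M$ a median graph and $\mathcal{X}=(X_a)_{a\in V(M)}$ subsets of $V(G)$ such that (M1) every edge of $G$ has both ends in some $X_a$, and (M2) for every $v\in V(G)$, $X^{-1}(v)=\{a: v\in X_a\}$ is non-empty and convex in $M$; its width is $\max_a|X_a|$. For an edge $ab$ of $M$ let $W_{ab}=\{v\in V(M): d(v,a)<d(v,b)\}$, $U_{ab}$ the set of vertices of $W_{ab}$ with a neighbour in $W_{ba}$, and $Z_{ab}=\bigcup_{x\in U_{ab}}X_x$. The decomposition is $\Theta$-smooth if for every edge $ab\in E(M)$ we have $|Z_{ab}\setminus Z_{ba}|=|Z_{ba}\setminus Z_{ab}|=1$ and, writing $Z_{ab}\setminus Z_{ba}=\{v_a\}$ and $Z_{ba}\setminus Z_{ab}=\{v_b\}$, the set $X^{-1}(v_a)\cup X^{-1}(v_b)$ is convex in $M$. The smooth-medianwidth $\mathrm{smw}(G)$ is the minimum width over all $\Theta$-smooth median decompositions of $G$. *)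

theory Defs
  imports "Graph_Theory.Graph_Theory"
begin

text \<open>
  A finite simple undirected graph is a \<^locale>\<open>pair_graph\<close>: finitely many vertices and a
  symmetric irreflexive set of arcs, the undirected edge \<open>uv\<close> being the two arcs \<open>(u, v)\<close> and
  \<open>(v, u)\<close>. The graph without vertices is a \<^locale>\<open>pair_graph\<close>, but it is not
  \<^const>\<open>connected\<close>, so a median graph always has a vertex.
\<close>

definition proper_colouring :: "'a pair_pre_digraph \<Rightarrow> nat \<Rightarrow> ('a \<Rightarrow> nat) \<Rightarrow> bool" where
  "proper_colouring G k c \<longleftrightarrow>
     c ` pverts G \<subseteq> {..<k} \<and> (\<forall>(u, v) \<in> parcs G. c u \<noteq> c v)"

definition chromatic_number :: "'a pair_pre_digraph \<Rightarrow> nat" where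
  "chromatic_number G = (LEAST k. \<exists>c. proper_colouring G k c)"

definition path_between :: "'m pair_pre_digraph \<Rightarrow> 'm \<Rightarrow> 'm list \<Rightarrow> 'm \<Rightarrow> bool" where
  "path_between M u p v \<longleftrightarrow> vpath p M \<and> hd p = u \<and> last p = v"

text \<open>Only meaningful when some path joins \<open>u\<close> and \<open>v\<close>; it is used for connected graphs only.\<close>

definition graph_dist :: "'m pair_pre_digraph \<Rightarrow> 'm \<Rightarrow> 'm \<Rightarrow> nat" where
  "graph_dist M u v = (LEAST n. \<exists>p. path_between M u p v \<and> vwalk_length p = n)"

definition interval :: "'m pair_pre_digraph \<Rightarrow> 'm \<Rightarrow> 'm \<Rightarrow> 'm set" where
  "interval M u v =
     {w. \<exists>p. path_between M u p v \<and> vwalk_length p = graph_dist M u v \<and> w \<in> set p}"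

definition convex_set :: "'m pair_pre_digraph \<Rightarrow> 'm set \<Rightarrow> bool" where
  "convex_set M S \<longleftrightarrow> S \<subseteq> pverts M \<and> (\<forall>u \<in> S. \<forall>v \<in> S. interval M u v \<subseteq> S)"

definition median_graph :: "'m pair_pre_digraph \<Rightarrow> bool" where
  "median_graph M \<longleftrightarrow> pair_graph M \<and> connected M \<and>
     (\<forall>u \<in> pverts M. \<forall>v \<in> pverts M. \<forall>w \<in> pverts M.
        card (interval M u v \<inter> interval M v w \<inter> interval M w u) = 1)"

definition bags_containing :: "'m pair_pre_digraph \<Rightarrow> ('m \<Rightarrow> 'a set) \<Rightarrow> 'a \<Rightarrow> 'm set" where
  "bags_containing M X v = {a \<in> pverts M. v \<in> X a}"

definition median_decomposition ::
    "'a pair_pre_digraph \<Rightarrow> 'm pair_pre_digraph \<Rightarrow> ('m \<Rightarrow> 'a set) \<Rightarrow> bool" where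
  "median_decomposition G M X \<longleftrightarrow>
     median_graph M \<and>
     (\<forall>a \<in> pverts M. X a \<subseteq> pverts G) \<and>
     (\<forall>(u, v) \<in> parcs G. \<exists>a \<in> pverts M. u \<in> X a \<and> v \<in> X a) \<and>
     (\<forall>v \<in> pverts G. bags_containing M X v \<noteq> {} \<and> convex_set M (bags_containing M X v))"

definition decomposition_width :: "'m pair_pre_digraph \<Rightarrow> ('m \<Rightarrow> 'a set) \<Rightarrow> nat" where
  "decomposition_width M X = (MAX a \<in> pverts M. card (X a))"

definition W_side :: "'m pair_pre_digraph \<Rightarrow> 'm \<Rightarrow> 'm \<Rightarrow> 'm set" where
  "W_side M a b = {v \<in> pverts M. graph_dist M v a < graph_dist M v b}"

definition U_side :: "'m pair_pre_digraph \<Rightarrow> 'm \<Rightarrow> 'm \<Rightarrow> 'm set" where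
  "U_side M a b = {v \<in> W_side M a b. \<exists>w \<in> W_side M b a. (v, w) \<in> parcs M}"

definition Z_side :: "'m pair_pre_digraph \<Rightarrow> ('m \<Rightarrow> 'a set) \<Rightarrow> 'm \<Rightarrow> 'm \<Rightarrow> 'a set" where
  "Z_side M X a b = (\<Union>x \<in> U_side M a b. X x)"

definition Theta_smooth :: "'m pair_pre_digraph \<Rightarrow> ('m \<Rightarrow> 'a set) \<Rightarrow> bool" where
  "Theta_smooth M X \<longleftrightarrow>
     (\<forall>(a, b) \<in> parcs M. \<exists>va vb.
        Z_side M X a b - Z_side M X b a = {va} \<and>
        Z_side M X b a - Z_side M X a b = {vb} \<and>
        convex_set M (bags_containing M X va \<union> bags_containing M X vb))"

text \<open>
  The median graph ranges over graphs with natural numbers as vertices, since a definition cannot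
  quantify over types. No decomposition is lost, as every finite graph is isomorphic to one of
  these: see \<open>smw_le_decomposition_width\<close> below.
\<close>

definition smw :: "'a pair_pre_digraph \<Rightarrow> nat" where
  "smw G = (LEAST k. \<exists>(M :: nat pair_pre_digraph) X.
     median_decomposition G M X \<and> Theta_smooth M X \<and> decomposition_width M X = k)"


definition relabel :: "('m \<Rightarrow> 'n) \<Rightarrow> 'm pair_pre_digraph \<Rightarrow> 'n pair_pre_digraph" where
  "relabel f M = \<lparr>pverts = f ` pverts M, parcs = map_prod f f ` parcs M\<rparr>"

lemma relabel_simps [simp]:
  "pverts (relabel f M) = f ` pverts M"
  "parcs (relabel f M) = map_prod f f ` parcs M"
  by (simp_all add: relabel_def)

locale relabelling = pair_graph M for M :: "'m pair_pre_digraph" +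
  fixes f :: "'m \<Rightarrow> 'n" and g :: "'n \<Rightarrow> 'm"
  assumes gf [simp]: "x \<in> pverts M \<Longrightarrow> g (f x) = x"
begin

abbreviation "N \<equiv> relabel f M"

lemma f_eq [simp]: "x \<in> pverts M \<Longrightarrow> y \<in> pverts M \<Longrightarrow> f x = f y \<longleftrightarrow> x = y"
  by (metis gf)

lemma inj_f: "inj_on f (pverts M)"
  by (rule inj_onI) simp

lemma arcD: "(x, y) \<in> parcs M \<Longrightarrow> x \<in> pverts M \<and> y \<in> pverts M"
  using in_arcsD1 in_arcsD2 by blast

lemma arc_iff [simp]:
  assumes "x \<in> pverts M" "y \<in> pverts M"
  shows "(f x, f y) \<in> map_prod f f ` parcs M \<longleftrightarrow> (x, y) \<in> parcs M"
  using assms arcD by (force simp: image_iff)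

lemma vwalk_arcs_map: "vwalk_arcs (map f p) = map (map_prod f f) (vwalk_arcs p)"
  by (induction p rule: vwalk_arcs.induct) auto

lemma vwalk_arcs_sub: "e \<in> set (vwalk_arcs p) \<Longrightarrow> fst e \<in> set p \<and> snd e \<in> set p"
  by (induction p rule: vwalk_arcs.induct) auto

lemma vpath_map:
  assumes "set p \<subseteq> pverts M"
  shows "vpath (map f p) N \<longleftrightarrow> vpath p M"
proof -
  have "set (vwalk_arcs (map f p)) \<subseteq> parcs N \<longleftrightarrow> set (vwalk_arcs p) \<subseteq> parcs M"
  proof -
    have "map_prod f f e \<in> map_prod f f ` parcs M \<longleftrightarrow> e \<in> parcs M"
      if "e \<in> set (vwalk_arcs p)" for e
      using vwalk_arcs_sub[OF that] assms arc_iff[of "fst e" "snd e"]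
      by (metis map_prod_simp prod.collapse subsetD)
    then show ?thesis
      unfolding vwalk_arcs_map set_map relabel_simps image_subset_iff by (auto simp only: subset_iff)
  qed
  moreover have "distinct (map f p) \<longleftrightarrow> distinct p"
    using inj_on_subset[OF inj_f assms] by (simp add: distinct_map)
  ultimately show ?thesis
    using assms by (auto simp: vpath_def vwalk_def)
qed

lemma path_between_relabel:
  assumes "u \<in> pverts M" "v \<in> pverts M"
  shows "path_between N (f u) q (f v) \<longleftrightarrow> (\<exists>p. q = map f p \<and> path_between M u p v)"
proof
  assume q: "path_between N (f u) q (f v)"
  then have sub: "set q \<subseteq> f ` pverts M" and ne: "q \<noteq> []"
    by (auto simp: path_between_def vpath_def vwalk_def)
  define p where "p = map g q"
  have qp: "q = map f p" using sub by (auto simp: p_def intro!: map_idI[symmetric])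
  have sp: "set p \<subseteq> pverts M" using sub by (auto simp: p_def)
  have "hd p \<in> pverts M" "last p \<in> pverts M" using sp ne qp by auto
  with q ne qp have "path_between M u p v"
    using vpath_map[OF sp] assms by (auto simp: path_between_def hd_map last_map)
  with qp show "\<exists>p. q = map f p \<and> path_between M u p v" by blast
next
  assume "\<exists>p. q = map f p \<and> path_between M u p v"
  then obtain p where p: "q = map f p" "path_between M u p v" by blast
  then have "set p \<subseteq> pverts M" "p \<noteq> []"
    by (auto simp: path_between_def vpath_def vwalk_def)
  with p show "path_between N (f u) q (f v)"
    using vpath_map[of p] by (auto simp: path_between_def hd_map last_map)
qed

lemma graph_dist_relabel [simp]:
  assumes "u \<in> pverts M" "v \<in> pverts M"
  shows "graph_dist N (f u) (f v) = graph_dist M u v"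
proof -
  have "(\<exists>q. path_between N (f u) q (f v) \<and> vwalk_length q = n) \<longleftrightarrow>
        (\<exists>p. path_between M u p v \<and> vwalk_length p = n)" for n
    using assms by (auto simp: path_between_relabel)
  then show ?thesis by (simp add: graph_dist_def)
qed

lemma interval_sub: "interval M u v \<subseteq> pverts M"
  by (auto simp: interval_def path_between_def vpath_def vwalk_def)

lemma interval_relabel [simp]:
  assumes "u \<in> pverts M" "v \<in> pverts M"
  shows "interval N (f u) (f v) = f ` interval M u v"
proof -
  have "w \<in> interval N (f u) (f v) \<longleftrightarrow>
      (\<exists>p. path_between M u p v \<and> vwalk_length p = graph_dist M u v \<and> w \<in> f ` set p)" for w
    using assms by (auto simp: interval_def path_between_relabel)
  then show ?thesis
    unfolding interval_def[of M] by blast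
qed

lemma convex_set_relabel:
  assumes "convex_set M S"
  shows "convex_set N (f ` S)"
proof -
  have sub: "S \<subseteq> pverts M" using assms by (simp add: convex_set_def)
  have "interval N (f u) (f v) \<subseteq> f ` S" if "u \<in> S" "v \<in> S" for u v
  proof -
    have "interval N (f u) (f v) = f ` interval M u v"
      using that sub by (intro interval_relabel) blast+
    moreover have "interval M u v \<subseteq> S"
      using that assms unfolding convex_set_def by blast
    ultimately show ?thesis by blast
  qed
  then show ?thesis using sub unfolding convex_set_def relabel_simps by blast
qed

lemma pair_graph_relabel: "pair_graph N"
proof
  fix e assume "e \<in> parcs N"
  then obtain x y where e: "e = (f x, f y)" and xy: "(x, y) \<in> parcs M" by auto
  then have "x \<in> pverts M" "y \<in> pverts M" "x \<noteq> y"
    using arcD[OF xy] pair_no_loops[OF xy] by auto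
  with e show "fst e \<in> pverts N" "snd e \<in> pverts N" "fst e \<noteq> snd e" by auto
next
  show "finite (pverts N)" "finite (parcs N)"
    using pair_finite_verts pair_finite_arcs by simp_all
  have "sym (parcs M)" using pair_sym_arcs by (simp add: symmetric_def)
  then show "symmetric (with_proj N)"
    unfolding symmetric_def sym_def with_proj_simps relabel_simps by blast
qed

lemma connected_relabel:
  assumes "connected M"
  shows "connected N"
proof -
  interpret N: pair_graph N by (rule pair_graph_relabel)
  have step: "f u \<rightarrow>\<^sup>*\<^bsub>with_proj N\<^esub> f v" if "u \<rightarrow>\<^sup>*\<^bsub>with_proj M\<^esub> v" for u v
    using that unfolding reachable_def
  proof (induction rule: rtrancl_on.induct)
    case (rtrancl_on_refl a)
    then show ?case by simp
  next
    case (rtrancl_on_into_rtrancl_on a b c)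
    from rtrancl_on_into_rtrancl_on(4) show ?case
      by (rule rtrancl_on.rtrancl_on_into_rtrancl_on)
        (use rtrancl_on_into_rtrancl_on(2,3) in auto)
  qed
  have sc: "strongly_connected (with_proj M)"
    using symmetric_connected_imp_strongly_connected[OF pair_sym_arcs assms] .
  have reach: "u \<rightarrow>\<^sup>*\<^bsub>with_proj M\<^esub> v" if "u \<in> pverts M" "v \<in> pverts M" for u v
    using sc that unfolding strongly_connected_def with_proj_simps by blast
  have "pverts N \<noteq> {}"
    using sc unfolding strongly_connected_def with_proj_simps relabel_simps by blast
  moreover have "x \<rightarrow>\<^sup>*\<^bsub>with_proj (mk_symmetric N)\<^esub> y" if "x \<in> pverts N" "y \<in> pverts N" for x y
  proof -
    from that obtain u v where "x = f u" "y = f v" "u \<in> pverts M" "v \<in> pverts M"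
      unfolding relabel_simps by blast
    then show ?thesis
      using N.reachable_mk_symmetricI[OF step[OF reach]] by blast
  qed
  ultimately show ?thesis
    unfolding connected_def strongly_connected_def by simp
qed

lemma median_graph_relabel:
  assumes "median_graph M"
  shows "median_graph N"
proof -
  have "card (f ` interval M u v \<inter> f ` interval M v w \<inter> f ` interval M w u) =
        card (interval M u v \<inter> interval M v w \<inter> interval M w u)" (is "card ?l = card ?r") for u v w
  proof -
    have "?l = f ` ?r"
      using inj_on_image_Int[OF inj_f] interval_sub by (metis inf.coboundedI1)
    moreover have "inj_on f ?r"
      using inj_on_subset[OF inj_f] interval_sub by (metis inf.coboundedI1)
    ultimately show ?thesis by (simp add: card_image)
  qed
  then show ?thesis
    using assms pair_graph_relabel connected_relabel unfolding median_graph_def by simp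
qed

lemma bags_containing_relabel [simp]:
  "bags_containing N (X \<circ> g) v = f ` bags_containing M X v"
  by (auto simp: bags_containing_def)

lemma W_side_relabel:
  "a \<in> pverts M \<Longrightarrow> b \<in> pverts M \<Longrightarrow> W_side N (f a) (f b) = f ` W_side M a b"
  by (auto simp: W_side_def)

lemma W_side_sub: "W_side M a b \<subseteq> pverts M"
  by (auto simp: W_side_def)

lemma U_side_relabel:
  assumes "a \<in> pverts M" "b \<in> pverts M"
  shows "U_side N (f a) (f b) = f ` U_side M a b"
proof -
  have "(f v, f w) \<in> map_prod f f ` parcs M \<longleftrightarrow> (v, w) \<in> parcs M"
    if "v \<in> W_side M a b" "w \<in> W_side M b a" for v w
    using that W_side_sub by (intro arc_iff) blast+
  moreover have "W_side N (f a) (f b) = f ` W_side M a b" "W_side N (f b) (f a) = f ` W_side M b a"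
    using assms by (simp_all add: W_side_relabel)
  ultimately have "f v \<in> U_side N (f a) (f b) \<longleftrightarrow> v \<in> U_side M a b" if "v \<in> W_side M a b" for v
    using that W_side_sub inj_on_image_mem_iff[OF inj_f _ W_side_sub]
    by (auto simp: U_side_def)
  moreover have "U_side N (f a) (f b) \<subseteq> f ` W_side M a b"
    using assms by (auto simp: U_side_def W_side_relabel)
  moreover have "U_side M a b \<subseteq> W_side M a b"
    by (auto simp: U_side_def)
  ultimately show ?thesis by blast
qed

lemma Z_side_relabel:
  assumes "a \<in> pverts M" "b \<in> pverts M"
  shows "Z_side N (X \<circ> g) (f a) (f b) = Z_side M X a b"
proof -
  have "g (f x) = x" if "x \<in> U_side M a b" for x
    using that W_side_sub[of a b] by (intro gf) (auto simp: U_side_def)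
  then show ?thesis using assms by (simp add: Z_side_def U_side_relabel)
qed

lemma median_decomposition_relabel:
  assumes "median_decomposition G M X"
  shows "median_decomposition G N (X \<circ> g)"
proof -
  have "\<exists>a \<in> pverts N. u \<in> (X \<circ> g) a \<and> v \<in> (X \<circ> g) a" if "(u, v) \<in> parcs G" for u v
  proof -
    obtain a where "a \<in> pverts M" "u \<in> X a" "v \<in> X a"
      using assms \<open>(u, v) \<in> parcs G\<close> unfolding median_decomposition_def by blast
    then show ?thesis by (intro bexI[of _ "f a"]) simp_all
  qed
  moreover have "(X \<circ> g) a \<subseteq> pverts G" if "a \<in> pverts N" for a
    using assms that by (auto simp: median_decomposition_def)
  moreover have "bags_containing N (X \<circ> g) v \<noteq> {} \<and> convex_set N (bags_containing N (X \<circ> g) v)"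
    if "v \<in> pverts G" for v
    using assms that convex_set_relabel unfolding median_decomposition_def bags_containing_relabel
    by blast
  ultimately show ?thesis
    using assms median_graph_relabel unfolding median_decomposition_def by blast
qed

lemma Theta_smooth_relabel:
  assumes "Theta_smooth M X"
  shows "Theta_smooth N (X \<circ> g)"
  unfolding Theta_smooth_def
proof (rule ballI, clarify)
  fix a' b' assume "(a', b') \<in> parcs N"
  then obtain a b where ab: "(a, b) \<in> parcs M" "a' = f a" "b' = f b" by auto
  then obtain va vb where v:
      "Z_side M X a b - Z_side M X b a = {va}" "Z_side M X b a - Z_side M X a b = {vb}"
      "convex_set M (bags_containing M X va \<union> bags_containing M X vb)"
    using assms unfolding Theta_smooth_def by blast
  have "Z_side N (X \<circ> g) a' b' = Z_side M X a b" "Z_side N (X \<circ> g) b' a' = Z_side M X b a"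
    using ab arcD[OF ab(1)] by (simp_all add: Z_side_relabel)
  moreover have "convex_set N (bags_containing N (X \<circ> g) va \<union> bags_containing N (X \<circ> g) vb)"
    using convex_set_relabel[OF v(3)] by (simp add: image_Un)
  ultimately show "\<exists>va vb.
      Z_side N (X \<circ> g) a' b' - Z_side N (X \<circ> g) b' a' = {va} \<and>
      Z_side N (X \<circ> g) b' a' - Z_side N (X \<circ> g) a' b' = {vb} \<and>
      convex_set N (bags_containing N (X \<circ> g) va \<union> bags_containing N (X \<circ> g) vb)"
    using v(1,2) by auto
qed

lemma decomposition_width_relabel:
  "decomposition_width N (X \<circ> g) = decomposition_width M X"
  by (simp add: decomposition_width_def image_image)

end

lemma smw_le_decomposition_width:
  fixes G :: "'a pair_pre_digraph" and M :: "'m pair_pre_digraph"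
  assumes "median_decomposition G M X" "Theta_smooth M X"
  shows "smw G \<le> decomposition_width M X"
proof -
  from assms have pg: "pair_graph M"
    by (simp add: median_decomposition_def median_graph_def)
  then have "finite (pverts M)"
    by (simp add: pair_graph_def pair_digraph_def pair_fin_digraph_def pair_fin_digraph_axioms_def)
  then obtain f :: "'m \<Rightarrow> nat" where "inj_on f (pverts M)"
    using finite_imp_inj_to_nat_seg by metis
  with pg interpret relabelling M f "inv_into (pverts M) f"
    by (simp add: relabelling_def relabelling_axioms_def)
  show ?thesis
    unfolding smw_def
    by (rule Least_le)
      (use assms median_decomposition_relabel Theta_smooth_relabel
        decomposition_width_relabel in blast)
qed

text \<open>
  Both minima are attained: \<^const>\<open>chromatic_number\<close> by an injective colouring, and
  \<^const>\<open>smw\<close> because the one-vertex median graph with bag \<^term>\<open>pverts G\<close> is a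
  smooth decomposition.
\<close>

lemma chromatic_number_attained:
  assumes "pair_graph G"
  shows "\<exists>c. proper_colouring G (chromatic_number G) c"
proof -
  interpret pair_graph G by fact
  obtain c :: "'a \<Rightarrow> nat" and k where c: "c ` pverts G = {i. i < k}" "inj_on c (pverts G)"
    using finite_imp_inj_to_nat_seg[OF pair_finite_verts] by metis
  have "c u \<noteq> c v" if "(u, v) \<in> parcs G" for u v
    using that c(2) in_arcsD1[OF that] in_arcsD2[OF that] pair_no_loops[OF that]
    unfolding inj_on_def by auto
  then have "proper_colouring G k c"
    using c(1) unfolding proper_colouring_def by auto
  then have "\<exists>k c. proper_colouring G k c" by blast
  then show ?thesis
    unfolding chromatic_number_def by (rule LeastI_ex)
qed

lemma smw_attained:
  assumes "pair_graph G"
  shows "\<exists>(M :: nat pair_pre_digraph) X.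
    median_decomposition G M X \<and> Theta_smooth M X \<and> decomposition_width M X = smw G"
proof -
  interpret G: pair_graph G by fact
  define K :: "nat pair_pre_digraph" where "K = \<lparr>pverts = {0}, parcs = {}\<rparr>"
  have K: "pverts K = {0}" "parcs K = {}" by (simp_all add: K_def)
  have pg: "pair_graph K"
    by unfold_locales (auto simp: K symmetric_def sym_def)
  have path: "path_between K 0 p 0 \<longleftrightarrow> p = [0]" for p
    by (cases p rule: vwalk_arcs.cases)
      (auto simp: path_between_def vpath_def vwalk_def K)
  have int: "interval K 0 0 = {0}"
    by (simp add: interval_def path graph_dist_def)
  have "connected K"
    by (auto simp: connected_conv K)
  then have med: "median_graph K"
    using pg by (simp add: median_graph_def K int)
  have bags: "bags_containing K (\<lambda>_. pverts G) v = {0}" if "v \<in> pverts G" for v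
    using that by (auto simp: bags_containing_def K)
  have "convex_set K {0}"
    by (simp add: convex_set_def K int)
  then have "median_decomposition G K (\<lambda>_. pverts G)"
    using med bags G.in_arcsD1 G.in_arcsD2 by (auto simp: median_decomposition_def K)
  moreover have "Theta_smooth K (\<lambda>_. pverts G)"
    by (simp add: Theta_smooth_def K)
  ultimately have "\<exists>k (M :: nat pair_pre_digraph) X.
      median_decomposition G M X \<and> Theta_smooth M X \<and> decomposition_width M X = k"
    by blast
  then show ?thesis
    unfolding smw_def by (rule LeastI_ex)
qed

end

theory Submission
  imports Defs
begin

text \<open>
  A colouring with \<open>k\<close> colours yields a \<open>\<Theta>\<close>-smooth decomposition over the Cartesian product of
  \<open>k\<close> paths, one per colour class, the bag of a grid point consisting of the vertices that it
  selects: this gives \<open>smw G \<le> \<chi>(G)\<close>. Conversely, in a \<open>\<Theta>\<close>-smooth decomposition the bags of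
  adjacent vertices \<open>a\<close>, \<open>b\<close> of \<open>M\<close> either agree or differ by exchanging \<open>v_a\<close> for \<open>v_b\<close>, so every
  edge of \<open>M\<close> carries a bijection between its bags. Opposite edges of a square of \<open>M\<close> are
  \<open>\<Theta>\<close>-equivalent and exchange the same pair, hence these bijections commute around squares, and by
  the quadrangle property of median graphs the transport to a fixed root bag along geodesics does
  not depend on the geodesic. As supports are convex, the image of a vertex of \<open>G\<close> does not depend
  on the bag from which it is transported either; it is a colour from the root bag, and distinct
  vertices of a common bag receive distinct colours.
\<close>

section \<open>Walks, distances and intervals in connected graphs\<close>

lemma length_vwalk_to_vpath_le: "length (vwalk_to_vpath p) \<le> length p"
  by (induction p rule: vwalk_to_vpath.induct) (auto intro: order_trans[OF _ length_dropWhile_le] le_SucI)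

lemma length_vwalk_to_vpath_less:
  assumes "\<not> distinct p"
  shows "length (vwalk_to_vpath p) < length p"
  using assms
proof (induction p)
  case (Cons x p)
  show ?case
  proof (cases "x \<in> set p")
    case True
    have "length (vwalk_to_vpath (dropWhile (\<lambda>y. y \<noteq> x) p)) \<le> length p"
      using length_vwalk_to_vpath_le length_dropWhile_le order_trans by blast
    then show ?thesis using True by simp
  qed (use Cons in auto)
qed simp

locale connected_pair_graph = pair_graph M for M :: "'m pair_pre_digraph" +
  assumes connected: "connected M"
begin

abbreviation V where "V \<equiv> pverts M"
abbreviation E where "E \<equiv> parcs M"
abbreviation d where "d \<equiv> graph_dist M"
abbreviation I where "I \<equiv> interval M"

lemma ex_geodesic:
  assumes "u \<in> V" "v \<in> V"
  obtains p where "path_between M u p v" "vwalk_length p = d u v"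
proof -
  have "u \<rightarrow>\<^sup>*\<^bsub>with_proj M\<^esub> v"
    using symmetric_connected_imp_strongly_connected[OF pair_sym_arcs connected] assms
    unfolding strongly_connected_def by simp
  then have "\<exists>n p. path_between M u p v \<and> vwalk_length p = n"
    unfolding reachable_vpath_conv path_between_def by blast
  then have "\<exists>p. path_between M u p v \<and> vwalk_length p = d u v"
    unfolding graph_dist_def by (rule LeastI_ex)
  then show ?thesis using that by blast
qed

lemma path_dist_le: "path_between M u p v \<Longrightarrow> d u v \<le> vwalk_length p"
  unfolding graph_dist_def by (rule Least_le) blast

lemma walk_imp_path_between:
  assumes "vwalk p M" "hd p = u" "last p = v"
  shows "path_between M u (vwalk_to_vpath p) v"
  using assms vwalk_to_vpath_vpath
  by (auto simp: path_between_def vwalk_to_vpath_hd vwalk_to_vpath_last)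

lemma walk_dist_le:
  assumes "vwalk p M" "hd p = u" "last p = v"
  shows "d u v \<le> vwalk_length p"
  using path_dist_le[OF walk_imp_path_between[OF assms]] length_vwalk_to_vpath_le[of p]
  unfolding vwalk_length_simp by linarith

lemma dist_le_one: "(u, v) \<in> E \<Longrightarrow> d u v \<le> 1"
  using walk_dist_le[of "[u, v]" u v] in_arcsD1 in_arcsD2 by (auto simp: vwalk_def)

lemma dist_eq_0 [simp]:
  assumes "u \<in> V" "v \<in> V"
  shows "d u v = 0 \<longleftrightarrow> u = v"
proof
  assume "d u v = 0"
  then obtain p where p: "path_between M u p v" "vwalk_length p = 0"
    using ex_geodesic[OF assms] by metis
  then show "u = v" by (cases p) (auto simp: path_between_def)
next
  assume "u = v"
  then show "d u v = 0" using walk_dist_le[of "[u]" u u] assms by auto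
qed

lemma dist_self [simp]: "u \<in> V \<Longrightarrow> d u u = 0"
  using dist_eq_0[of u u] by blast

lemma dist_sym:
  assumes "u \<in> V" "v \<in> V"
  shows "d u v = d v u"
proof -
  have *: "d v u \<le> d u v" if uv: "u \<in> V" "v \<in> V" for u v
  proof -
    obtain p where p: "path_between M u p v" "vwalk_length p = d u v"
      using ex_geodesic[OF uv] .
    then have "vwalk (rev p) M" "hd (rev p) = v" "last (rev p) = u"
      using vwalk_rev_ex[OF pair_sym_arcs, of p]
      by (auto simp: path_between_def vpath_def hd_rev last_rev)
    from walk_dist_le[OF this] p show ?thesis by simp
  qed
  show ?thesis using *[of u v] *[of v u] assms by simp
qed

lemma dist_triangle:
  assumes "u \<in> V" "w \<in> V" "v \<in> V"
  shows "d u v \<le> d u w + d w v"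
proof -
  obtain p where p: "path_between M u p w" "vwalk_length p = d u w"
    using ex_geodesic assms by metis
  obtain q where q: "path_between M w q v" "vwalk_length q = d w v"
    using ex_geodesic assms by metis
  have j: "joinable p q"
    using p q by (auto simp: path_between_def vpath_def)
  have "vwalk (p \<oplus> q) M"
    using p q j by (auto simp: path_between_def vpath_def intro: vwalk_joinI_vwalk)
  moreover have "hd (p \<oplus> q) = u" "last (p \<oplus> q) = v"
    using p q j by (auto simp: path_between_def vwalk_join_hd vwalk_join_last)
  ultimately have "d u v \<le> vwalk_length (p \<oplus> q)" by (rule walk_dist_le)
  then show ?thesis
    using vwalk_join_vwalk_length[OF j] p q by linarith
qed

text \<open>A geodesic splits at \<open>w\<close> into two walks, so the triangle inequality is
  tight. Conversely, two geodesics joined at \<open>w\<close> form a walk of length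
  \<open>d u v\<close>; a repetition in it would yield a shorter path. From here on intervals are
  handled through distances alone.\<close>

lemma mem_interval_iff:
  assumes "u \<in> V" "v \<in> V"
  shows "w \<in> I u v \<longleftrightarrow> w \<in> V \<and> d u w + d w v = d u v"
proof
  assume "w \<in> I u v"
  then obtain p where p: "path_between M u p v" "vwalk_length p = d u v" "w \<in> set p"
    by (auto simp: interval_def)
  have w: "w \<in> V" using p by (auto simp: path_between_def vpath_def dest: vwalk_verts_in_verts)
  obtain q r where qr: "p = q \<oplus> r" "last q = w" "hd r = w" "q \<noteq> []" "r \<noteq> []"
    using vwalk_join_split[OF p(3)] by blast
  then have j: "joinable q r" by simp
  have "vwalk p M" using p by (auto simp: path_between_def)
  then have "vwalk q M" "vwalk r M"
    using vwalkI_vwalk_join_l vwalkI_vwalk_join_r j qr by metis+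
  moreover have "hd q = u" "last r = v"
    using p(1) vwalk_join_hd[OF j] vwalk_join_last[OF j]
    unfolding qr(1) path_between_def by simp_all
  ultimately have "d u w \<le> vwalk_length q" "d w v \<le> vwalk_length r"
    using walk_dist_le qr by metis+
  then have "d u w + d w v \<le> d u v"
    using p(2) vwalk_join_vwalk_length[OF j] unfolding qr(1) by linarith
  then show "w \<in> V \<and> d u w + d w v = d u v"
    using w dist_triangle[of u w v] assms by simp
next
  assume w: "w \<in> V \<and> d u w + d w v = d u v"
  obtain p where p: "path_between M u p w" "vwalk_length p = d u w"
    using ex_geodesic assms w by metis
  obtain q where q: "path_between M w q v" "vwalk_length q = d w v"
    using ex_geodesic assms w by metis
  let ?r = "p \<oplus> q"
  have j: "joinable p q"
    using p q by (auto simp: path_between_def vpath_def)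
  have r: "vwalk ?r M" "hd ?r = u" "last ?r = v"
    using p q j
    by (auto simp: path_between_def vpath_def vwalk_join_hd vwalk_join_last intro: vwalk_joinI_vwalk)
  have len: "vwalk_length ?r = d u v"
    using vwalk_join_vwalk_length[OF j] p q w by linarith
  have "distinct ?r"
  proof (rule ccontr)
    assume "\<not> distinct ?r"
    then have "length (vwalk_to_vpath ?r) < length ?r" by (rule length_vwalk_to_vpath_less)
    moreover have "vwalk_to_vpath ?r \<noteq> []" using r(1) vwalk_to_vpath_nonempty by blast
    ultimately have "vwalk_length (vwalk_to_vpath ?r) < vwalk_length ?r"
      by (cases "vwalk_to_vpath ?r") auto
    then show False
      using path_dist_le[OF walk_imp_path_between[OF r]] len by simp
  qed
  then have "path_between M u ?r v"
    using r by (auto simp: path_between_def)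
  moreover have "w \<in> set ?r"
    using p last_in_set[OF joinable_non_Nil(1)[OF j]] by (auto simp: vwalk_join_def path_between_def)
  ultimately show "w \<in> I u v" using len by (auto simp: interval_def)
qed

lemma dist_arc: "(u, v) \<in> E \<Longrightarrow> d u v = 1"
  using dist_le_one[of u v] dist_eq_0[of u v] in_arcsD1 in_arcsD2 pair_no_loops by fastforce

lemma dist_Suc_neighbour:
  assumes "u \<in> V" "v \<in> V" "u \<noteq> v"
  obtains y where "(u, y) \<in> E" "d u v = Suc (d y v)"
proof -
  obtain p where p: "path_between M u p v" "vwalk_length p = d u v"
    using ex_geodesic assms by metis
  then obtain y q where q: "p = u # y # q"
    using assms by (cases p rule: vwalk_arcs.cases) (auto simp: path_between_def vpath_def)
  have arc: "(u, y) \<in> E" and "vwalk (y # q) M"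
    using p q by (auto simp: path_between_def vpath_def)
  moreover have "last (y # q) = v" using p q by (auto simp: path_between_def)
  ultimately have "d y v \<le> length q"
    using walk_dist_le[of "y # q" y v] by simp
  moreover have "d u v = Suc (length q)" using p q by simp
  moreover have "d u v \<le> Suc (d y v)"
    using dist_triangle[of u y v] dist_arc[OF arc] assms in_arcsD2[OF arc] by simp
  ultimately show ?thesis using that arc by simp
qed

lemma arc_iff_dist:
  assumes "u \<in> V" "v \<in> V"
  shows "(u, v) \<in> E \<longleftrightarrow> d u v = 1"
proof
  assume 1: "d u v = 1"
  then have "u \<noteq> v" using assms dist_eq_0[of u v] by auto
  then obtain y where y: "(u, y) \<in> E" "d u v = Suc (d y v)"
    using dist_Suc_neighbour assms by metis
  then have "y = v" using 1 assms(2) in_arcsD2[OF y(1)] by simp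
  then show "(u, v) \<in> E" using y by simp
qed (rule dist_arc)

end

text \<open>Identifies the distance of a concrete graph without handling paths:
  \<open>D_next\<close> provides a descent from \<open>x\<close> to \<open>z\<close> in
  \<open>D x z\<close> steps, and by \<open>D_step\<close> no walk between them is shorter.\<close>

lemma connected_graph_distI:
  fixes M :: "'m pair_pre_digraph" and D :: "'m \<Rightarrow> 'm \<Rightarrow> nat"
  assumes "pair_graph M" and ne: "pverts M \<noteq> {}"
    and D0: "\<And>x. x \<in> pverts M \<Longrightarrow> D x x = 0"
    and D_step: "\<And>x y z. (x, y) \<in> parcs M \<Longrightarrow> z \<in> pverts M \<Longrightarrow> D x z \<le> Suc (D y z)"
    and D_next: "\<And>x z. x \<in> pverts M \<Longrightarrow> z \<in> pverts M \<Longrightarrow> x \<noteq> z \<Longrightarrow>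
      \<exists>y. (x, y) \<in> parcs M \<and> D x z = Suc (D y z)"
  shows "connected M"
    and "\<And>x z. x \<in> pverts M \<Longrightarrow> z \<in> pverts M \<Longrightarrow> graph_dist M x z = D x z"
proof -
  interpret pair_graph M by fact
  have reach: "x \<rightarrow>\<^sup>*\<^bsub>with_proj M\<^esub> z" if "x \<in> pverts M" "z \<in> pverts M" for x z
    using that
  proof (induction "D x z" arbitrary: x rule: less_induct)
    case less
    show ?case
    proof (cases "x = z")
      case False
      then obtain y where y: "(x, y) \<in> parcs M" "D x z = Suc (D y z)"
        using D_next less.prems by blast
      then have "y \<rightarrow>\<^sup>*\<^bsub>with_proj M\<^esub> z" using less in_arcsD2 by simp
      then show ?thesis using y(1) by (rule adj_reachable_trans[rotated]) 
    qed (use less in simp)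
  qed
  show conn: "connected M"
    using ne reachable_mk_symmetricI[OF reach]
    unfolding connected_def by (intro strongly_connectedI) simp_all
  interpret connected_pair_graph M by unfold_locales (rule conn)
  show "d x z = D x z" if "x \<in> V" "z \<in> V" for x z
  proof (rule antisym)
    show "d x z \<le> D x z" using that
    proof (induction "D x z" arbitrary: x rule: less_induct)
      case less
      show ?case
      proof (cases "x = z")
        case False
        then obtain y where y: "(x, y) \<in> parcs M" "D x z = Suc (D y z)"
          using D_next less.prems by blast
        then have "d y z \<le> D y z" using less in_arcsD2 by simp
        then show ?thesis 
          using dist_triangle[of x y z] dist_arc[OF y(1)] y less.prems in_arcsD2[OF y(1)] by simp
      qed (use less in simp)
    qed
    show "D x z \<le> d x z" using that
    proof (induction "d x z" arbitrary: x rule: less_induct)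
      case less
      show ?case
      proof (cases "x = z")
        case False
        then obtain y where y: "(x, y) \<in> parcs M" "d x z = Suc (d y z)"
          using dist_Suc_neighbour less.prems by blast
        then have "D y z \<le> d y z" using less in_arcsD2 by simp
        then show ?thesis using D_step[OF y(1), of z] y less.prems by simp
      qed (use less D0 in simp)
    qed
  qed
qed

section \<open>Median graphs and their half-spaces\<close>

locale median_pair_graph = connected_pair_graph +
  assumes card_medians: "u \<in> V \<Longrightarrow> v \<in> V \<Longrightarrow> w \<in> V \<Longrightarrow> card (I u v \<inter> I v w \<inter> I w u) = 1"

lemma median_pair_graph_iff: "median_pair_graph M \<longleftrightarrow> median_graph M"
  by (simp add: median_pair_graph_def median_pair_graph_axioms_def connected_pair_graph_def
      connected_pair_graph_axioms_def median_graph_def Ball_def)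

context median_pair_graph
begin

abbreviation W where "W \<equiv> W_side M"

lemma mem_W_iff: "z \<in> W a b \<longleftrightarrow> z \<in> V \<and> d z a < d z b"
  by (simp add: W_side_def)

lemma median_unique:
  assumes "u \<in> V" "v \<in> V" "w \<in> V"
    and "x \<in> I u v" "x \<in> I v w" "x \<in> I w u" "y \<in> I u v" "y \<in> I v w" "y \<in> I w u"
  shows "x = y"
  using card_medians[OF assms(1-3)] assms(4-9) by (metis card_1_singletonE IntI singletonD)

lemma ex_median:
  assumes "u \<in> V" "v \<in> V" "w \<in> V"
  obtains x where "x \<in> I u v" "x \<in> I v w" "x \<in> I w u"
  using card_medians[OF assms] by (metis card_1_singletonE IntD1 IntD2 singletonI)

text \<open>The median of \<open>x\<close>, \<open>y\<close>, \<open>z\<close> lies between the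
  adjacent vertices \<open>x\<close> and \<open>y\<close>, so it is one of them, and that one is on
  a geodesic from \<open>z\<close> to the other. This is the bipartiteness of median graphs.\<close>

lemma dist_arc_cases:
  assumes "(x, y) \<in> E" "z \<in> V"
  shows "d z x = Suc (d z y) \<or> d z y = Suc (d z x)"
proof -
  have xy: "x \<in> V" "y \<in> V" "d x y = 1" "d y x = 1"
    using assms in_arcsD1 in_arcsD2 dist_arc arcs_symmetric by blast+
  obtain m where m: "m \<in> I x y" "m \<in> I y z" "m \<in> I z x"
    using ex_median xy assms by metis
  then have mV: "m \<in> V" using mem_interval_iff[of x y m] xy by blast
  have "d x m + d m y = 1" using m(1) mem_interval_iff[of x y m] xy by simp
  then have "d x m = 0 \<or> d m y = 0" by linarith
  then have "m = x \<or> m = y" using xy mV by auto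
  then show ?thesis
    using m xy assms dist_sym[of x z] dist_sym[of y z]
    by (auto simp: mem_interval_iff)
qed

lemma W_disjoint: "z \<in> W a b \<Longrightarrow> z \<notin> W b a"
  by (simp add: mem_W_iff)

lemma W_cases: "(a, b) \<in> E \<Longrightarrow> z \<in> V \<Longrightarrow> z \<in> W a b \<or> z \<in> W b a"
  using dist_arc_cases[of a b z] by (auto simp: mem_W_iff)

lemma W_self: "(a, b) \<in> E \<Longrightarrow> a \<in> W a b"
  using dist_arc[of a b] in_arcsD1[of a b] by (simp add: mem_W_iff)

lemma W_interval:
  assumes "(a, b) \<in> E" "y \<in> W a b"
  shows "a \<in> I b y"
proof -
  have ab: "a \<in> V" "b \<in> V" "y \<in> V" "d b a = 1"
    using assms in_arcsD1 in_arcsD2 dist_arc arcs_symmetric by (auto simp: mem_W_iff)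
  have "d y b = Suc (d y a)"
    using dist_arc_cases[OF assms(1), of y] assms(2) by (auto simp: mem_W_iff)
  then show ?thesis
    using ab dist_sym[of y a] dist_sym[of y b] by (simp add: mem_interval_iff)
qed

lemma dist_2:
  assumes "(x, y) \<in> E" "(x, y') \<in> E" "y \<noteq> y'"
  shows "d y y' = 2"
proof -
  have V: "x \<in> V" "y \<in> V" "y' \<in> V" using assms in_arcsD1 in_arcsD2 by blast+
  have 1: "d y x = 1" "d x y' = 1" using assms dist_arc arcs_symmetric by blast+
  have "d y y' \<le> 2" using dist_triangle[of y x y'] V 1 by simp
  moreover have "d y y' \<noteq> 0" using V assms by simp
  moreover have "d y y' = Suc (d y x) \<or> d y x = Suc (d y y')"
    using dist_arc_cases[OF assms(2), of y] V by blast
  ultimately show ?thesis using 1 by linarith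
qed

text \<open>The median \<open>w\<close> of \<open>y\<close>, \<open>y'\<close>, \<open>z\<close>
  lies on a geodesic between \<open>y\<close> and \<open>y'\<close>, which are at distance 2; as
  these are equally far from \<open>z\<close>, both are at distance 1 from \<open>w\<close>.\<close>

lemma quadrangle:
  assumes "(x, y) \<in> E" "(x, y') \<in> E" "y \<noteq> y'" "z \<in> V"
    and "d x z = Suc (d y z)" "d x z = Suc (d y' z)"
  obtains w where "(y, w) \<in> E" "(y', w) \<in> E" "d y z = Suc (d w z)"
proof -
  have V: "x \<in> V" "y \<in> V" "y' \<in> V" using assms in_arcsD1 in_arcsD2 by blast+
  obtain w where w: "w \<in> I y y'" "w \<in> I y' z" "w \<in> I z y"
    using ex_median V assms by metis
  then have wV: "w \<in> V" using mem_interval_iff[of y y' w] V by blast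
  have "d y w + d w y' = 2" "d y' w + d w z = d y' z" "d z w + d w y = d z y"
    using w V assms dist_2[OF assms(1-3)] by (simp_all add: mem_interval_iff)
  moreover have "d w y' = d y' w" "d z w = d w z" "d w y = d y w" "d z y = d y z"
    using V wV assms dist_sym by blast+
  ultimately have "d y w = 1" "d y' w = 1" "d y z = Suc (d w z)" using assms by linarith+
  then show ?thesis using that[of w] V wV by (simp add: arc_iff_dist)
qed

text \<open>If \<open>z\<close> is nearer to \<open>x\<close> than to \<open>y\<close> but not
  nearer to \<open>y'\<close> than to \<open>w\<close>, parity puts \<open>x\<close> and
  \<open>w\<close> at equal distance from \<open>z\<close>, and \<open>y\<close>, \<open>y'\<close>
  one step further. Then \<open>x\<close> and \<open>w\<close> are two medians of \<open>y\<close>,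
  \<open>y'\<close>, \<open>z\<close>.\<close>

lemma W_square_subset:
  assumes "(x, y) \<in> E" "(y, w) \<in> E" "(x, y') \<in> E" "(y', w) \<in> E" "x \<noteq> w" "y \<noteq> y'"
  shows "W x y \<subseteq> W y' w"
proof
  fix z assume z: "z \<in> W x y"
  have V: "x \<in> V" "y \<in> V" "y' \<in> V" "w \<in> V" using assms in_arcsD1 in_arcsD2 by blast+
  have zV: "z \<in> V" and zxy: "d z x < d z y" using z by (auto simp: mem_W_iff)
  show "z \<in> W y' w"
  proof (rule ccontr)
    assume "z \<notin> W y' w"
    then have "d z w \<le> d z y'" using zV by (auto simp: mem_W_iff)
    moreover have "d z x = Suc (d z y) \<or> d z y = Suc (d z x)" "d z y = Suc (d z w) \<or> d z w = Suc (d z y)"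
      "d z x = Suc (d z y') \<or> d z y' = Suc (d z x)" "d z y' = Suc (d z w) \<or> d z w = Suc (d z y')"
      using dist_arc_cases assms zV by blast+
    ultimately have eq: "d z w = d z x" "d z y = Suc (d z x)" "d z y' = Suc (d z x)"
      using zxy by linarith+
    have yx: "d y x = 1" "d x y' = 1" "d y w = 1" "d w y' = 1" "d y' x = 1" "d y' w = 1"
        "d x y = 1" "d w y = 1"
      using assms dist_arc arcs_symmetric by blast+
    have "x \<in> I y y'" "w \<in> I y y'" "x \<in> I y' z" "w \<in> I y' z" "x \<in> I z y" "w \<in> I z y"
      using V zV yx eq dist_2[OF assms(1,3,6)]
        dist_sym[of z x] dist_sym[of z y'] dist_sym[of z w]
      by (simp_all add: mem_interval_iff)
    then show False using median_unique[of y y' z x w] V zV assms by blast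
  qed
qed

lemma W_square:
  assumes "(x, y) \<in> E" "(y, w) \<in> E" "(x, y') \<in> E" "(y', w) \<in> E" "x \<noteq> w" "y \<noteq> y'"
  shows "W x y = W y' w"
  using W_square_subset[OF assms] W_square_subset[of y' w y x] assms arcs_symmetric by blast

text \<open>A geodesic from \<open>u\<close> to \<open>z\<close> must leave \<open>W a b\<close>,
  and \<open>s'\<close> is its first vertex after doing so. With \<open>s'\<close> on the geodesic,
  convexity of supports reaches the far side of the cut.\<close>

lemma interval_crossing:
  assumes "(a, b) \<in> E" "u \<in> W a b" "z \<in> W b a"
  obtains s s' where "(s, s') \<in> E" "s \<in> W a b" "s' \<in> W b a" "s' \<in> I u z"
proof -
  have "\<exists>s s'. (s, s') \<in> E \<and> s \<in> W a b \<and> s' \<in> W b a \<and> s' \<in> I u z"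
    using assms(2)
  proof (induction "d u z" arbitrary: u rule: less_induct)
    case less
    have V: "u \<in> V" "z \<in> V" using less.prems assms by (auto simp: mem_W_iff)
    have "u \<noteq> z" using less.prems assms W_disjoint by blast
    then obtain y where y: "(u, y) \<in> E" "d u z = Suc (d y z)"
      using dist_Suc_neighbour V by metis
    have yV: "y \<in> V" and uy: "d u y = 1" using y in_arcsD2 dist_arc by blast+
    show ?case
    proof (cases "y \<in> W a b")
      case False
      then have "y \<in> W b a" using W_cases[OF assms(1)] yV by blast
      moreover have "y \<in> I u z" using V yV uy y by (simp add: mem_interval_iff)
      ultimately show ?thesis using y less.prems by blast
    next
      case True
      then obtain s s' where s: "(s, s') \<in> E" "s \<in> W a b" "s' \<in> W b a" "s' \<in> I y z"
        using less.hyps[of y] y by auto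
      have "s' \<in> V" "d y s' + d s' z = d y z" using s V yV by (simp_all add: mem_interval_iff)
      moreover from this have "d u s' \<le> d u y + d y s'" "d u z \<le> d u s' + d s' z"
        using dist_triangle V yV by blast+
      ultimately have "s' \<in> I u z" using V yV uy y by (simp add: mem_interval_iff)
      with s show ?thesis by blast
    qed
  qed
  then show ?thesis using that by blast
qed

end

section \<open>Exchange of vertices between adjacent bags\<close>

locale smooth_median_decomposition = median_pair_graph M
  for M :: "'m pair_pre_digraph" +
  fixes G :: "'a pair_pre_digraph" and X :: "'m \<Rightarrow> 'a set"
  assumes decomposition: "median_decomposition G M X" and smooth: "Theta_smooth M X"
begin

abbreviation supp where "supp \<equiv> bags_containing M X"
abbreviation Z where "Z \<equiv> Z_side M X"

lemma mem_supp: "a \<in> supp v \<longleftrightarrow> a \<in> V \<and> v \<in> X a"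
  by (simp add: bags_containing_def)

lemma bag_sub: "a \<in> V \<Longrightarrow> X a \<subseteq> pverts G"
  using decomposition by (simp add: median_decomposition_def)

lemma supp_interval:
  assumes "a \<in> V" "b \<in> V" "v \<in> X a" "v \<in> X b" "c \<in> I a b"
  shows "v \<in> X c"
proof -
  have "v \<in> pverts G" using assms bag_sub by blast
  then have "convex_set M (supp v)"
    using decomposition by (simp add: median_decomposition_def)
  moreover have "a \<in> supp v" "b \<in> supp v" using assms by (simp_all add: mem_supp)
  ultimately have "c \<in> supp v" using assms(5) unfolding convex_set_def by blast
  then show ?thesis by (simp add: mem_supp)
qed

text \<open>In the paper's notation, \<open>swap_out a b\<close> is \<open>v_a\<close>, and \<open>v_b\<close> is \<open>swap_out b a\<close>.\<close>

definition swap_out :: "'m \<Rightarrow> 'm \<Rightarrow> 'a" where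
  "swap_out a b = the_elem (Z a b - Z b a)"

lemma swap_out:
  assumes "(a, b) \<in> E"
  shows Z_diff: "Z a b - Z b a = {swap_out a b}"
    and convex_swap: "convex_set M (supp (swap_out a b) \<union> supp (swap_out b a))"
proof -
  obtain va vb where "Z a b - Z b a = {va}" "Z b a - Z a b = {vb}"
      "convex_set M (supp va \<union> supp vb)"
    using smooth assms unfolding Theta_smooth_def by blast
  then show "Z a b - Z b a = {swap_out a b}" 
    "convex_set M (supp (swap_out a b) \<union> supp (swap_out b a))"
    by (simp_all add: swap_out_def)
qed

lemma mem_ZI:
  assumes "u \<in> W a b" "w \<in> W b a" "(u, w) \<in> E" "t \<in> X u"
  shows "t \<in> Z a b"
  using assms by (auto simp: Z_side_def U_side_def)

lemma ZE:
  assumes "t \<in> Z a b"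
  obtains u where "u \<in> W a b" "t \<in> X u"
  using assms by (auto simp: Z_side_def U_side_def)

lemma ex_swap_out_bag:
  assumes "(a, b) \<in> E"
  obtains u where "u \<in> W a b" "swap_out a b \<in> X u"
  using Z_diff[OF assms] ZE by blast

text \<open>If \<open>swap_out a b\<close> also occurred across the cut, a geodesic between the two
  occurrences would cross it, and convexity of the support would put this vertex into the bag at the
  far end \<open>s'\<close> of a crossing arc, hence into \<open>Z b a\<close>.\<close>

lemma swap_out_W:
  assumes "(a, b) \<in> E" "z \<in> V" "swap_out a b \<in> X z"
  shows "z \<in> W a b"
proof (rule ccontr)
  assume "z \<notin> W a b"
  then have z: "z \<in> W b a" using W_cases assms by blast
  obtain u where u: "u \<in> W a b" "swap_out a b \<in> X u" using ex_swap_out_bag assms by blast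
  then obtain s s' where s: "(s, s') \<in> E" "s \<in> W a b" "s' \<in> W b a" "s' \<in> I u z"
    using interval_crossing[OF assms(1) u(1) z] by blast
  have "swap_out a b \<in> X s'"
    using supp_interval[OF _ assms(2) u(2) assms(3) s(4)] u by (simp add: mem_W_iff)
  then have "swap_out a b \<in> Z b a" using s mem_ZI arcs_symmetric by blast
  then show False using Z_diff[OF assms(1)] by blast
qed

lemma swap_out_notin: 
  assumes "(a, b) \<in> E" 
  shows "swap_out a b \<notin> X b"
  using swap_out_W[OF assms, of b] in_arcsD2[OF assms] W_disjoint W_self arcs_symmetric assms by blast

text \<open>Apart from \<open>swap_out a b\<close>, all of \<open>Z a b\<close> recurs in
  \<open>Z b a\<close>, hence in some bag over \<open>W b a\<close>; \<open>b\<close> lies between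
  \<open>a\<close> and that bag, so convexity of the support applies.\<close>

lemma bag_step:
  assumes "(a, b) \<in> E" "t \<in> X a" "t \<noteq> swap_out a b"
  shows "t \<in> X b"
proof -
  have ba: "(b, a) \<in> E" using assms arcs_symmetric by blast
  then have "t \<in> Z a b" using mem_ZI[OF W_self W_self] assms by blast
  then have "t \<in> Z b a" using Z_diff[OF assms(1)] assms(3) by blast
  then obtain u where u: "u \<in> W b a" "t \<in> X u" by (rule ZE)
  then show ?thesis
    using supp_interval[of a u t b] W_interval[OF ba u(1)] assms in_arcsD1[OF assms(1)]
    by (simp add: mem_W_iff)
qed

text \<open>\<open>b\<close> lies between \<open>a\<close> and a bag of \<open>swap_out b a\<close>,
  so the convex union of the two supports contains it, while \<open>X b\<close> cannot contain
  \<open>swap_out a b\<close>. This is where the convexity condition of \<Theta>-smoothness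
  enters.\<close>

lemma bag_swap:
  assumes "(a, b) \<in> E" "swap_out a b \<in> X a"
  shows "swap_out b a \<in> X b"
proof -
  have ba: "(b, a) \<in> E" using assms arcs_symmetric by blast
  have aV: "a \<in> V" using assms in_arcsD1 by blast
  obtain y where y: "y \<in> W b a" "swap_out b a \<in> X y" using ex_swap_out_bag[OF ba] .
  have "a \<in> supp (swap_out a b) \<union> supp (swap_out b a)"
    "y \<in> supp (swap_out a b) \<union> supp (swap_out b a)"
    using assms y aV by (auto simp: mem_supp mem_W_iff)
  then have "b \<in> supp (swap_out a b) \<union> supp (swap_out b a)"
    using convex_swap[OF assms(1)] W_interval[OF ba y(1)] unfolding convex_set_def by blast
  then show ?thesis using swap_out_notin[OF assms(1)] by (auto simp: mem_supp)
qed

text \<open>Restricted to \<open>X a\<close> this is the bijection onto \<open>X b\<close>; it is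
  the identity there when \<open>X a\<close> lacks \<open>swap_out a b\<close>.\<close>

definition swap :: "'m \<Rightarrow> 'm \<Rightarrow> 'a \<Rightarrow> 'a" where
  "swap a b t = (if t = swap_out a b then swap_out b a else t)"

lemma swap_in: "(a, b) \<in> E \<Longrightarrow> t \<in> X a \<Longrightarrow> swap a b t \<in> X b"
  using bag_step bag_swap by (auto simp: swap_def)

lemma swap_swap: "(a, b) \<in> E \<Longrightarrow> t \<in> X a \<Longrightarrow> swap b a (swap a b t) = t"
  using swap_out_notin[of b a] arcs_symmetric by (auto simp: swap_def)

lemma swap_id: "(a, b) \<in> E \<Longrightarrow> t \<in> X b \<Longrightarrow> swap a b t = t"
  using swap_out_notin by (auto simp: swap_def)

text \<open>\<open>swap_out\<close> depends on the arc only through its two half-spaces, which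
  opposite arcs of a square share.\<close>

lemma swap_out_square:
  assumes "(x, y) \<in> E" "(y, w) \<in> E" "(x, y') \<in> E" "(y', w) \<in> E" "x \<noteq> w" "y \<noteq> y'"
  shows "swap_out x y = swap_out y' w" "swap_out y x = swap_out w y'"
proof -
  have "W x y = W y' w" by (rule W_square) fact+
  moreover have "W y x = W w y'"
    using assms arcs_symmetric by (intro W_square) blast+
  ultimately show "swap_out x y = swap_out y' w" "swap_out y x = swap_out w y'"
    by (simp_all add: swap_out_def Z_side_def U_side_def)
qed

text \<open>Both routes exchange \<open>p\<close> for \<open>q\<close> and \<open>r\<close> for
  \<open>s\<close>, in opposite orders, so it suffices that no element of \<open>X x\<close> is
  moved by both exchanges.\<close>

lemma swap_square:
  assumes E: "(x, y) \<in> E" "(y, w) \<in> E" "(x, y') \<in> E" "(y', w) \<in> E" "x \<noteq> w" "y \<noteq> y'"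
    and t: "t \<in> X x"
  shows "swap y w (swap x y t) = swap y' w (swap x y' t)"
proof -
  define p q r s where pqrs: "p = swap_out x y" "q = swap_out y x" "r = swap_out x y'" "s = swap_out y' x"
  have opp: "swap_out y' w = p" "swap_out w y' = q" "swap_out y w = r" "swap_out w y = s"
    using swap_out_square[of x y w y'] swap_out_square[of x y' w y] assms pqrs by auto
  have E': "(y, x) \<in> E" "(w, y) \<in> E" "(y', x) \<in> E" "(w, y') \<in> E"
    using E arcs_symmetric by blast+
  have notin: "p \<notin> X y" "q \<notin> X x" "p \<notin> X w" "q \<notin> X y'" "r \<notin> X y'" "s \<notin> X x" "r \<notin> X w" "s \<notin> X y"
    using swap_out_notin E E' pqrs opp by metis+
  have swaps: "p \<in> X x \<Longrightarrow> q \<in> X y" "p \<in> X y' \<Longrightarrow> q \<in> X w" "r \<in> X x \<Longrightarrow> s \<in> X y'" "r \<in> X y \<Longrightarrow> s \<in> X w"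
    "q \<in> X w \<Longrightarrow> p \<in> X y'"
    using bag_swap E E' pqrs opp by metis+
  have steps: "\<And>t. t \<in> X x \<Longrightarrow> t \<noteq> p \<Longrightarrow> t \<in> X y" "\<And>t. t \<in> X x \<Longrightarrow> t \<noteq> r \<Longrightarrow> t \<in> X y'"
    "\<And>t. t \<in> X y \<Longrightarrow> t \<noteq> r \<Longrightarrow> t \<in> X w"
    using bag_step E E' pqrs opp by metis+
  \<comment> \<open>Otherwise \<open>q\<close>, which lies in \<open>X y\<close>, would differ from
    \<open>r\<close> and persist in \<open>X w\<close>; exchanging back from \<open>w\<close> to
    \<open>y'\<close> would put \<open>p\<close> into \<open>X y'\<close>, where \<open>r\<close>
    cannot occur.\<close>
  have "p \<noteq> r" if "p \<in> X x"
    using that notin swaps steps by metis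
  \<comment> \<open>The first exchange must not produce what the second removes:
    \<open>q = r\<close> would put \<open>r\<close> into \<open>X w\<close> by way of
    \<open>y'\<close>, and \<open>s = p\<close> would put \<open>p\<close> there by way of
    \<open>y\<close>.\<close>
  then have "t = p \<Longrightarrow> t \<noteq> r \<and> q \<noteq> r" "t = r \<Longrightarrow> t \<noteq> p \<and> s \<noteq> p"
    using t notin swaps steps by metis+
  then show ?thesis
    unfolding swap_def opp pqrs[symmetric] by (cases "t = p"; cases "t = r") simp_all
qed

section \<open>Transport to a root bag and the resulting colouring\<close>

context
  fixes root
  assumes root: "root \<in> V"
begin

text \<open>For \<open>x\<close> other than \<open>root\<close>, an arbitrary neighbour one step
  closer to it; \<open>transport_down\<close> shows that the choice is immaterial.\<close>

definition parent :: "'m \<Rightarrow> 'm" where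
  "parent x = (SOME y. (x, y) \<in> E \<and> d x root = Suc (d y root))"

lemma parent:
  assumes "x \<in> V" "d x root = Suc n"
  shows "(x, parent x) \<in> E" "d (parent x) root = n"
proof -
  have "x \<noteq> root" using assms dist_eq_0[of x root] root by auto
  then have "\<exists>y. (x, y) \<in> E \<and> d x root = Suc (d y root)"
    using dist_Suc_neighbour assms root by metis
  from someI_ex[OF this] show "(x, parent x) \<in> E" "d (parent x) root = n"
    using assms unfolding parent_def[symmetric] by auto
qed

text \<open>The counter holds the remaining distance to \<open>root\<close>, so the recursion along
  parents is primitive.\<close>

primrec transport_aux :: "nat \<Rightarrow> 'm \<Rightarrow> 'a \<Rightarrow> 'a" where
  "transport_aux 0 x t = t"
| "transport_aux (Suc n) x t = transport_aux n (parent x) (swap x (parent x) t)"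

definition transport :: "'m \<Rightarrow> 'a \<Rightarrow> 'a" where
  "transport x = transport_aux (d x root) x"

lemma transport_parent:
  assumes "x \<in> V" "d x root = Suc n"
  shows "transport x t = transport (parent x) (swap x (parent x) t)"
  using parent[OF assms] assms by (simp add: transport_def)

text \<open>The quadrangle property gives \<open>y\<close> and the parent of \<open>x\<close> a
  common neighbour \<open>w\<close> one step closer to \<open>root\<close>. By induction both
  transports pass through \<open>w\<close>, and \<open>swap_square\<close> identifies the two routes
  from \<open>x\<close> to \<open>w\<close>.\<close>

lemma transport_down:
  assumes "(x, y) \<in> E" "d x root = Suc (d y root)" "t \<in> X x"
  shows "transport x t = transport y (swap x y t)"
  using assms
proof (induction "d x root" arbitrary: x y t rule: less_induct)
  case less
  let ?p = "parent x"
  have xV: "x \<in> V" using less.prems in_arcsD1 by blast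
  have p: "(x, ?p) \<in> E" "d ?p root = d y root"
    using parent[OF xV less.prems(2)] by auto
  show ?case
  proof (cases "?p = y")
    case True
    then show ?thesis using transport_parent[OF xV less.prems(2)] by simp
  next
    case False
    then obtain w where w: "(y, w) \<in> E" "(?p, w) \<in> E" "d y root = Suc (d w root)"
      using quadrangle[of x y ?p root] less.prems p root by metis
    have "x \<noteq> w" using w less.prems by auto
    have "transport x t = transport ?p (swap x ?p t)"
      using transport_parent[OF xV less.prems(2)] .
    also have "\<dots> = transport w (swap ?p w (swap x ?p t))"
      using w p less.prems swap_in[OF p(1)] by (intro less.hyps) auto
    also have "swap ?p w (swap x ?p t) = swap y w (swap x y t)"
      using w p less.prems False \<open>x \<noteq> w\<close> by (intro swap_square) auto
    also have "transport w \<dots> = transport y (swap x y t)"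
      using w less.prems swap_in[OF less.prems(1)] by (intro less.hyps[symmetric]) auto
    finally show ?thesis .
  qed
qed

text \<open>On an arc leading away from \<open>root\<close>, the reverse arc descends and
  \<open>swap_swap\<close> inverts the exchange.\<close>

lemma transport_arc:
  assumes "(x, y) \<in> E" "t \<in> X x"
  shows "transport x t = transport y (swap x y t)"
proof -
  have V: "x \<in> V" "y \<in> V" using assms in_arcsD1 in_arcsD2 by blast+
  have yx: "(y, x) \<in> E" using assms arcs_symmetric by blast
  consider "d x root = Suc (d y root)" | "d y root = Suc (d x root)"
    using dist_arc_cases[OF assms(1) root] dist_sym V root by metis
  then show ?thesis
  proof cases
    case 1
    then show ?thesis using transport_down assms by blast
  next
    case 2
    then show ?thesis
      using transport_down[OF yx 2 swap_in[OF assms]] swap_swap[OF assms] by simp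
  qed
qed

text \<open>By convexity \<open>t\<close> stays in every bag along a geodesic from \<open>x\<close>
  to \<open>y\<close>, and an exchange fixes each vertex common to its two bags.\<close>

lemma transport_eq:
  assumes "x \<in> V" "y \<in> V" "t \<in> X x" "t \<in> X y"
  shows "transport x t = transport y t"
  using assms
proof (induction "d x y" arbitrary: x rule: less_induct)
  case less
  show ?case
  proof (cases "x = y")
    case False
    then obtain z where z: "(x, z) \<in> E" "d x y = Suc (d z y)"
      using dist_Suc_neighbour less.prems by metis
    have zV: "z \<in> V" and "d x z = 1" using z in_arcsD2 dist_arc by blast+
    then have "z \<in> I x y" using z less.prems by (simp add: mem_interval_iff)
    then have tz: "t \<in> X z" using supp_interval less.prems by blast
    then have "transport x t = transport z t"
      using transport_arc[OF z(1)] swap_id[OF z(1)] less.prems by metis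
    also have "\<dots> = transport y t" using z tz zV less.prems by (intro less.hyps) auto
    finally show ?thesis .
  qed simp
qed

lemma transport_inj:
  assumes "x \<in> V"
  shows "inj_on (transport x) (X x) \<and> transport x ` X x \<subseteq> X root"
  using assms
proof (induction "d x root" arbitrary: x)
  case 0
  then have "x = root" using root by simp
  then show ?case using 0 by (auto simp: transport_def)
next
  case (Suc n)
  let ?p = "parent x"
  have p: "(x, ?p) \<in> E" "d ?p root = n" using parent[of x n] Suc by auto
  have IH: "inj_on (transport ?p) (X ?p)" "transport ?p ` X ?p \<subseteq> X root"
    using Suc p in_arcsD2 by auto
  have eq: "transport x t = transport ?p (swap x ?p t)" for t
    using transport_parent Suc by metis
  have "inj_on (swap x ?p) (X x)"
    using swap_swap[OF p(1)] by (metis inj_onI)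
  then have "inj_on (transport ?p \<circ> swap x ?p) (X x)"
    using swap_in[OF p(1)] by (intro comp_inj_on inj_on_subset[OF IH(1)] image_subsetI)
  moreover have "transport x = transport ?p \<circ> swap x ?p" using eq by auto
  ultimately show ?case using IH(2) swap_in[OF p(1)] eq by auto
qed

lemma chromatic_number_le_card_bag:
  assumes "pair_graph G"
  shows "chromatic_number G \<le> card (X root)"
proof -
  interpret G: pair_graph G by fact
  \<comment> \<open>Transport from an arbitrarily chosen bag; by \<open>transport_eq\<close> every
    bag of \<open>v\<close> gives the same colour.\<close>
  define col where "col v = transport (SOME x. x \<in> supp v) v" for v
  have col: "col v = transport x v" if "x \<in> V" "v \<in> X x" for x v
  proof -
    have "x \<in> supp v" using that by (simp add: mem_supp)
    then have "(SOME x. x \<in> supp v) \<in> supp v" by (rule someI)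
    then show ?thesis unfolding col_def using that by (intro transport_eq) (simp_all add: mem_supp)
  qed
  have "finite (X root)" using bag_sub[OF root] G.pair_finite_verts finite_subset by blast
  then obtain e where e: "bij_betw e (X root) {..<card (X root)}"
    using ex_bij_betw_finite_nat[of "X root"] by (auto simp: atLeast0LessThan)
  have inX: "col v \<in> X root" if "v \<in> pverts G" for v
  proof -
    have "supp v \<noteq> {}" using that decomposition by (simp add: median_decomposition_def)
    then obtain x where x: "x \<in> V" "v \<in> X x" by (auto simp: mem_supp)
    then show ?thesis using transport_inj[OF x(1)] by (auto simp: col[OF x])
  qed
  have "col u \<noteq> col v" if uv: "(u, v) \<in> parcs G" for u v
  proof -
    \<comment> \<open>Adjacent vertices meet in a common bag, on which transport is
      injective.\<close>
    obtain x where x: "x \<in> V" "u \<in> X x" "v \<in> X x"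
      using decomposition uv unfolding median_decomposition_def by blast
    moreover have "u \<noteq> v" using G.pair_no_loops[OF uv] by simp
    ultimately show ?thesis
      using col transport_inj[OF x(1)] by (auto dest: inj_onD)
  qed
  then have "e (col u) \<noteq> e (col v)" if "(u, v) \<in> parcs G" for u v
    using that inX e G.in_arcsD1 G.in_arcsD2 unfolding bij_betw_def inj_on_def by metis
  moreover have "(e \<circ> col) ` pverts G \<subseteq> {..<card (X root)}"
    using inX e unfolding bij_betw_def by force
  ultimately have "proper_colouring G (card (X root)) (e \<circ> col)"
    unfolding proper_colouring_def by auto
  then show ?thesis unfolding chromatic_number_def by (intro Least_le) blast
qed

end

end

lemma chromatic_number_le_width:
  assumes "pair_graph G" "median_decomposition G M X" "Theta_smooth M X"
  shows "chromatic_number G \<le> decomposition_width M X"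
proof -
  have "median_graph M" using assms(2) by (simp add: median_decomposition_def)
  then interpret smooth_median_decomposition M G X
    using assms(2,3) by (simp add: smooth_median_decomposition_def
        smooth_median_decomposition_axioms_def median_pair_graph_iff)
  obtain a where a: "a \<in> V"
    using connected by (auto simp: connected_def strongly_connected_def)
  have "card (X a) \<le> decomposition_width M X"
    unfolding decomposition_width_def using a pair_finite_verts by (intro Max_ge) auto
  then show ?thesis using chromatic_number_le_card_bag[OF a assms(1)] by simp
qed

section \<open>Grids as median graphs\<close>

locale grid =
  fixes k :: nat and n :: "nat \<Rightarrow> nat"
  assumes n_pos: "i < k \<Longrightarrow> n i > 0"
begin

text \<open>Truncated subtraction leaves at most one non-zero summand, so this is the absolute
  difference.\<close>

definition diff :: "nat \<Rightarrow> nat \<Rightarrow> nat" where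
  "diff x y = (x - y) + (y - x)"

lemma diff_less_Suc: "diff x y < diff x (Suc y) \<longleftrightarrow> x \<le> y"
  and diff_Suc_less: "diff x (Suc y) < diff x y \<longleftrightarrow> Suc y \<le> x"
  by (cases "x \<le> y"; simp add: diff_def)+

definition l1 :: "(nat \<Rightarrow> nat) \<Rightarrow> (nat \<Rightarrow> nat) \<Rightarrow> nat" where
  "l1 a b = (\<Sum>i<k. diff (a i) (b i))"

text \<open>Extensional functions make points that agree below \<open>k\<close> equal, and the set
  of points finite.\<close>

definition points :: "(nat \<Rightarrow> nat) set" where
  "points = (\<Pi>\<^sub>E i\<in>{..<k}. {..<n i})"

definition Grid :: "(nat \<Rightarrow> nat) pair_pre_digraph" where
  "Grid = \<lparr>pverts = points, parcs = {(a, b). a \<in> points \<and> b \<in> points \<and> l1 a b = 1}\<rparr>"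

lemma Grid_simps [simp]:
  "pverts Grid = points"
  "(a, b) \<in> parcs Grid \<longleftrightarrow> a \<in> points \<and> b \<in> points \<and> l1 a b = 1"
  by (simp_all add: Grid_def)

lemma points_less: "a \<in> points \<Longrightarrow> i < k \<Longrightarrow> a i < n i"
  by (auto simp: points_def)

lemma points_eqI:
  assumes "a \<in> points" "b \<in> points" "\<And>i. i < k \<Longrightarrow> a i = b i"
  shows "a = b"
  using assms unfolding points_def by (intro PiE_ext) auto

lemma points_upd: "a \<in> points \<Longrightarrow> i < k \<Longrightarrow> x < n i \<Longrightarrow> a(i := x) \<in> points"
  by (auto simp: points_def PiE_iff extensional_def)

lemma ex_point: 
  obtains a where "a \<in> points"
  using n_pos that[of "\<lambda>i\<in>{..<k}. 0"] by (auto simp: points_def)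

lemma l1_self [simp]: "l1 a a = 0"
  by (simp add: l1_def diff_def)

lemma l1_sym: "l1 a b = l1 b a"
  by (simp add: l1_def diff_def add.commute)

lemma l1_triangle: "l1 a b \<le> l1 a w + l1 w b"
  unfolding l1_def sum.distrib[symmetric] by (rule sum_mono) (simp add: diff_def)

lemma l1_upd:
  assumes "i < k"
  shows "l1 a b = diff (a i) (b i) + (\<Sum>j\<in>{..<k} - {i}. diff (a j) (b j))"
  unfolding l1_def using assms by (intro sum.remove) auto

text \<open>The triangle inequality holds in each coordinate, so equality of the sums forces
  equality in every coordinate. Hence intervals of the grid are boxes.\<close>

lemma l1_between_iff:
  "l1 a w + l1 w b = l1 a b \<longleftrightarrow> (\<forall>i<k. (a i \<le> w i \<and> w i \<le> b i) \<or> (b i \<le> w i \<and> w i \<le> a i))"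
  (is "_ \<longleftrightarrow> (\<forall>i<k. ?P i)")
proof -
  have *: "diff (a i) (w i) + diff (w i) (b i) = diff (a i) (b i) \<longleftrightarrow> ?P i" for i
    unfolding diff_def by arith
  have "diff (a i) (w i) + diff (w i) (b i) = diff (a i) (b i)"
    if "l1 a w + l1 w b = l1 a b" "i < k" for i
    using that sum_mono_inv[of "\<lambda>i. diff (a i) (b i)" "{..<k}"
        "\<lambda>i. diff (a i) (w i) + diff (w i) (b i)" i]
    unfolding l1_def sum.distrib[symmetric] by (auto simp: diff_def)
  moreover have "l1 a w + l1 w b = l1 a b" if "\<forall>i<k. ?P i"
    using that unfolding l1_def sum.distrib[symmetric] by (intro sum.cong) (simp_all add: *)
  ultimately show ?thesis using * by blast
qed

lemma l1_Suc_neighbour: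
  assumes "a \<in> points" "b \<in> points" "a \<noteq> b"
  shows "\<exists>y. (a, y) \<in> parcs Grid \<and> l1 a b = Suc (l1 y b)"
proof -
  obtain i where i: "i < k" "a i \<noteq> b i" using points_eqI assms by blast
  \<comment> \<open>One unit step from \<open>a i\<close> towards \<open>b i\<close>, hence still
    inside the path.\<close>
  define x where "x = (if a i < b i then Suc (a i) else a i - 1)"
  have "a i < n i" "b i < n i" using points_less assms i by blast+
  then have x: "x < n i" "diff (a i) x = 1" "diff (a i) (b i) = Suc (diff x (b i))"
    using i(2) by (simp_all add: x_def diff_def) linarith+
  have "l1 a (a(i := x)) = 1"
    using x by (simp add: l1_upd[OF i(1)] diff_def)
  moreover have "l1 a b = Suc (l1 (a(i := x)) b)"
    using x by (simp add: l1_upd[OF i(1)])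
  ultimately show ?thesis
    using points_upd[OF assms(1) i(1) x(1)] assms by (intro exI[of _ "a(i := x)"]) simp
qed

lemma pair_graph_Grid: "pair_graph Grid"
proof
  have "finite points" by (auto simp: points_def intro!: finite_PiE)
  moreover have "parcs Grid \<subseteq> points \<times> points" by auto
  ultimately show "finite (pverts Grid)" "finite (parcs Grid)"
    using finite_subset by auto
  show "symmetric (with_proj Grid)"
    by (auto simp: symmetric_def sym_def l1_sym)
qed auto

lemma l1_arc: "(a, b) \<in> parcs Grid \<Longrightarrow> l1 a z \<le> Suc (l1 b z)"
  using l1_triangle[of a z b] by simp

lemma connected_Grid: "connected Grid"
  and dist_Grid: "a \<in> points \<Longrightarrow> b \<in> points \<Longrightarrow> graph_dist Grid a b = l1 a b"
proof -
  obtain base where "base \<in> points" by (rule ex_point)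
  then have ne: "pverts Grid \<noteq> {}" by auto
  have next_point: "\<exists>y. (x, y) \<in> parcs Grid \<and> l1 x z = Suc (l1 y z)"
    if "x \<in> pverts Grid" "z \<in> pverts Grid" "x \<noteq> z" for x z
    using l1_Suc_neighbour[of x z] that unfolding Grid_simps(1) by blast
  note dist = connected_graph_distI[OF pair_graph_Grid ne l1_self l1_arc next_point]
  show "connected Grid" by (rule dist(1))
  show "graph_dist Grid a b = l1 a b" if "a \<in> points" "b \<in> points"
    using that by (intro dist(2)) simp_all
qed

sublocale Grid: connected_pair_graph Grid
  rewrites "pverts Grid = points"
  using connected_Grid pair_graph_Grid
  by (simp_all add: connected_pair_graph_def connected_pair_graph_axioms_def)

lemma mem_interval_Grid:
  assumes "a \<in> points" "b \<in> points"
  shows "w \<in> interval Grid a b \<longleftrightarrow>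
    w \<in> points \<and> (\<forall>i<k. (a i \<le> w i \<and> w i \<le> b i) \<or> (b i \<le> w i \<and> w i \<le> a i))"
  using assms l1_between_iff by (auto simp: Grid.mem_interval_iff dist_Grid)

text \<open>As intervals are boxes, medians can be computed coordinatewise, where the only common
  value is the middle one of three numbers.\<close>

lemma median_graph_Grid: "median_graph Grid"
proof -
  have "card (interval Grid a b \<inter> interval Grid b c \<inter> interval Grid c a) = 1"
    if abc: "a \<in> points" "b \<in> points" "c \<in> points" for a b c
  proof -
    define med where "med x y z = max (min x y) (min (max x y) z)" for x y z :: nat
    define m where "m = (\<lambda>i\<in>{..<k}. med (a i) (b i) (c i))"
    have med: "((x \<le> w \<and> w \<le> y) \<or> (y \<le> w \<and> w \<le> x)) \<and>
        ((y \<le> w \<and> w \<le> z) \<or> (z \<le> w \<and> w \<le> y)) \<and>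
        ((z \<le> w \<and> w \<le> x) \<or> (x \<le> w \<and> w \<le> z)) \<longleftrightarrow> w = med x y z" for x y z w
      unfolding med_def by (simp add: max_def min_def) arith
    have "med x y z < l" if "x < l" "y < l" "z < l" for x y z l
      using that by (auto simp: med_def)
    then have "m \<in> points"
      using abc unfolding points_def by (auto simp: m_def PiE_iff)
    then have "interval Grid a b \<inter> interval Grid b c \<inter> interval Grid c a =
        {w \<in> points. \<forall>i<k. w i = m i}"
      using abc by (auto simp: mem_interval_Grid m_def simp flip: med)
    also have "\<dots> = {m}" using \<open>m \<in> points\<close> points_eqI by blast
    finally show ?thesis by simp
  qed
  then show ?thesis
    using pair_graph_Grid connected_Grid by (simp add: median_graph_def)
qed

lemma arc_Grid_cases:
  assumes "(a, b) \<in> parcs Grid"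
  obtains i where "i < k" "b i = Suc (a i) \<or> a i = Suc (b i)" "\<And>j. j < k \<Longrightarrow> j \<noteq> i \<Longrightarrow> a j = b j"
proof -
  have "(\<Sum>i<k. diff (a i) (b i)) = 1" using assms by (simp add: l1_def)
  then obtain i where "i < k" "diff (a i) (b i) = 1" "\<forall>j<k. j \<noteq> i \<longrightarrow> diff (a j) (b j) = 0"
    unfolding sum_eq_1_iff[OF finite_lessThan] by auto
  then show ?thesis by (intro that[of i]) (auto simp: diff_def)
qed

text \<open>The half-spaces of an arc in direction \<open>i\<close> depend on coordinate
  \<open>i\<close> alone, and the arcs crossing between them join the two layers through
  \<open>a\<close> and \<open>b\<close>.\<close>

lemma U_side_Grid:
  assumes "a \<in> points" "b \<in> points" "i < k" and step: "b i = Suc (a i) \<or> a i = Suc (b i)"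
    and same: "\<And>j. j < k \<Longrightarrow> j \<noteq> i \<Longrightarrow> a j = b j"
  shows "U_side Grid a b = {w \<in> points. w i = a i}"
proof -
  have less: "l1 w a < l1 w b \<longleftrightarrow> diff (w i) (a i) < diff (w i) (b i)"
    "l1 w b < l1 w a \<longleftrightarrow> diff (w i) (b i) < diff (w i) (a i)" for w
    using same by (simp_all add: l1_upd[OF assms(3)])
  have U: "w \<in> U_side Grid a b \<longleftrightarrow> w \<in> points \<and> diff (w i) (a i) < diff (w i) (b i) \<and>
      (\<exists>w'\<in>points. diff (w' i) (b i) < diff (w' i) (a i) \<and> l1 w w' = 1)" for w
    using assms(1,2) by (auto simp: U_side_def W_side_def dist_Grid less)
  show ?thesis
  proof (intro set_eqI iffI)
    fix w assume "w \<in> U_side Grid a b"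
    then obtain w' where w: "w \<in> points" "diff (w i) (a i) < diff (w i) (b i)"
        "diff (w' i) (b i) < diff (w' i) (a i)" "l1 w w' = 1"
      using U by blast
    then have "diff (w i) (w' i) \<le> 1" using l1_upd[OF assms(3), of w w'] by simp
    \<comment> \<open>The situation on a single path: \<open>x\<close> is on the side of
      \<open>y\<close> and \<open>x'\<close> on the side of \<open>z\<close>, so being at most 1
      apart they must be the two ends of the step.\<close>
    moreover have "x = y" if "diff x y < diff x z" "diff x' z < diff x' y" "diff x x' \<le> 1"
        "z = Suc y \<or> y = Suc z" for x x' y z
      using that(4)
    proof
      assume z: "z = Suc y"
      then have "x \<le> y" "Suc y \<le> x'" using that(1,2) by (simp_all only: diff_less_Suc diff_Suc_less)
      then show "x = y" using that(3) by (simp add: diff_def)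
    next
      assume y: "y = Suc z"
      then have "Suc z \<le> x" "x' \<le> z" using that(1,2) by (simp_all only: diff_less_Suc diff_Suc_less)
      then show "x = y" using that(3) y by (simp add: diff_def)
    qed
    ultimately have "w i = a i" using w(2,3) step by blast
    then show "w \<in> {w \<in> points. w i = a i}" using w by blast
  next
    fix w assume w: "w \<in> {w \<in> points. w i = a i}"
    have "w(i := b i) \<in> points" using w assms points_less by (intro points_upd) auto
    moreover have "l1 w (w(i := b i)) = 1"
      using w step by (auto simp: l1_upd[OF assms(3)] diff_def)
    moreover have "diff (b i) (b i) < diff (b i) (a i)" "diff (a i) (a i) < diff (a i) (b i)"
      using step by (auto simp: diff_def)
    ultimately show "w \<in> U_side Grid a b"
      using w unfolding U by (intro conjI bexI[of _ "w(i := b i)"]) simp_all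
  qed
qed

end

section \<open>The decomposition obtained from a colouring\<close>

text \<open>A colour class with \<open>n\<close> vertices becomes a path with \<open>n\<close> vertices; an empty one becomes a
  single vertex, so that the grid stays non-empty. A point of the grid selects one vertex of each
  colour.\<close>

lemma smw_le_colours:
  assumes "pair_graph G" "proper_colouring G k c"
  shows "smw G \<le> k"
proof -
  interpret G: pair_graph G by fact
  define cls where "cls i = {v \<in> pverts G. c v = i}" for i
  have fin: "finite (cls i)" for i using G.pair_finite_verts by (simp add: cls_def)
  have "\<exists>e. bij_betw e (cls i) {..<card (cls i)}" for i
    using ex_bij_betw_finite_nat[OF fin] by (simp add: atLeast0LessThan)
  then obtain e where e: "bij_betw (e i) (cls i) {..<card (cls i)}" for i by metis
  define num where "num v = e (c v) v" for v
  define n where "n i = max 1 (card (cls i))" for i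
  interpret grid k n by unfold_locales (simp add: n_def)
  have ck: "c v < k" if "v \<in> pverts G" for v
    using that assms(2) by (auto simp: proper_colouring_def)
  have num_less: "num v < n (c v)" if "v \<in> pverts G" for v
  proof -
    have "v \<in> cls (c v)" using that by (simp add: cls_def)
    then have "num v \<in> {..<card (cls (c v))}" unfolding num_def using bij_betwE[OF e] by blast
    then show ?thesis by (simp add: n_def)
  qed
  have num_inj: "u = v" if "u \<in> pverts G" "v \<in> pverts G" "c u = c v" "num u = num v" for u v
    using that bij_betw_imp_inj_on[OF e[of "c v"]] by (auto simp: num_def cls_def dest: inj_onD)
  \<comment> \<open>The bound \<open>2 \<le> n i\<close> rules out an empty class, whose path has a
    point but no vertex of \<open>G\<close>.\<close>
  have num_surj: "\<exists>v \<in> pverts G. c v = i \<and> num v = x" if "x < n i" "2 \<le> n i" for x i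
  proof -
    have "x \<in> e i ` cls i" using e[of i] that by (auto simp: n_def bij_betw_def)
    then show ?thesis by (auto simp: num_def cls_def)
  qed
  define X where "X a = {v \<in> pverts G. num v = a (c v)}" for a
  have bags: "bags_containing Grid X v = {a \<in> points. a (c v) = num v}" if "v \<in> pverts G" for v
    using that by (auto simp: bags_containing_def X_def)
  obtain base where base: "base \<in> points" by (rule ex_point)
  have dec: "median_decomposition G Grid X"
  proof -
    have "\<exists>a \<in> points. u \<in> X a \<and> v \<in> X a" if uv: "(u, v) \<in> parcs G" for u v
    proof -
      have V: "u \<in> pverts G" "v \<in> pverts G" "c u \<noteq> c v"
        using uv assms(2) G.in_arcsD1 G.in_arcsD2 by (auto simp: proper_colouring_def)
      \<comment> \<open>The ends of an edge have different colours, so neither update overwrites the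
        other.\<close>
      then have "base(c u := num u, c v := num v) \<in> points"
        using base ck num_less by (intro points_upd) auto
      then show ?thesis using V by (intro bexI) (auto simp: X_def)
    qed
    moreover have "bags_containing Grid X v \<noteq> {}" if "v \<in> pverts G" for v
      using points_upd[OF base ck num_less] that by (auto simp: bags intro!: exI[of _ "base(c v := num v)"])
    moreover have "convex_set Grid (bags_containing Grid X v)" if "v \<in> pverts G" for v
      using ck[OF that] by (fastforce simp: bags[OF that] convex_set_def mem_interval_Grid)
    ultimately show ?thesis
      using median_graph_Grid by (auto simp: median_decomposition_def X_def)
  qed
  have "\<exists>va vb. Z_side Grid X a b - Z_side Grid X b a = {va} \<and>
        Z_side Grid X b a - Z_side Grid X a b = {vb} \<and>
        convex_set Grid (bags_containing Grid X va \<union> bags_containing Grid X vb)"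
    if ab: "(a, b) \<in> parcs Grid" for a b
  proof -
    obtain i where i: "i < k" "b i = Suc (a i) \<or> a i = Suc (b i)"
        and same: "\<And>j. j < k \<Longrightarrow> j \<noteq> i \<Longrightarrow> a j = b j"
      using arc_Grid_cases[OF ab] by blast
    have V: "a \<in> points" "b \<in> points" using ab by auto
    have less: "a i < n i" "b i < n i" using points_less V i by auto
    \<comment> \<open>Fixing coordinate \<open>i\<close> restricts colour class \<open>i\<close> to
      one position and leaves the other classes free, so two layers differ by one vertex each
      way.\<close>
    have Z: "(\<Union>w\<in>{w \<in> points. w i = x}. X w) = {v \<in> pverts G. c v = i \<longrightarrow> num v = x}"
      if x: "x < n i" for x
    proof (intro set_eqI iffI)
      fix v assume v: "v \<in> {v \<in> pverts G. c v = i \<longrightarrow> num v = x}"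
      then have "base(i := x, c v := num v) \<in> points"
        using base i x ck num_less by (intro points_upd) auto
      then show "v \<in> (\<Union>w\<in>{w \<in> points. w i = x}. X w)"
        using v by (intro UN_I[of "base(i := x, c v := num v)"]) (auto simp: X_def)
    qed (auto simp: X_def)
    have "U_side Grid a b = {w \<in> points. w i = a i}" "U_side Grid b a = {w \<in> points. w i = b i}"
      using V i same by (intro U_side_Grid; auto)+
    then have ZZ: "Z_side Grid X a b = {v \<in> pverts G. c v = i \<longrightarrow> num v = a i}"
      "Z_side Grid X b a = {v \<in> pverts G. c v = i \<longrightarrow> num v = b i}"
      using Z less by (simp_all add: Z_side_def)
    \<comment> \<open>\<open>a i\<close> and \<open>b i\<close> are distinct positions, so class
      \<open>i\<close> has a vertex at each.\<close>
    have "2 \<le> n i" using i less by auto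
    then obtain va vb where v: "va \<in> pverts G" "c va = i" "num va = a i"
        "vb \<in> pverts G" "c vb = i" "num vb = b i"
      using num_surj less by metis
    have "Z_side Grid X a b - Z_side Grid X b a = {va}" "Z_side Grid X b a - Z_side Grid X a b = {vb}"
      unfolding ZZ using v num_inj i by auto
    moreover have "bags_containing Grid X va \<union> bags_containing Grid X vb =
        {w \<in> points. w i = a i \<or> w i = b i}"
      using v by (auto simp: bags)
    \<comment> \<open>\<open>a i\<close> and \<open>b i\<close> are consecutive, so a box spanned by
      points of the two layers stays within them.\<close>
    moreover have "convex_set Grid {w \<in> points. w i = a i \<or> w i = b i}"
      using i by (fastforce simp: convex_set_def mem_interval_Grid)
    ultimately show ?thesis by auto
  qed
  then have "Theta_smooth Grid X" unfolding Theta_smooth_def by blast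
  with dec have "smw G \<le> decomposition_width Grid X" by (rule smw_le_decomposition_width)
  also have "\<dots> \<le> k"
  proof -
    \<comment> \<open>Vertices of one colour in a bag have the same position in their class and
      hence coincide.\<close>
    have "card (X a) \<le> k" for a
    proof -
      have "inj_on c (X a)" using num_inj by (auto simp: inj_on_def X_def)
      moreover have "c ` X a \<subseteq> {..<k}" using ck by (auto simp: X_def)
      ultimately show ?thesis using card_inj_on_le[of c "X a" "{..<k}"] by simp
    qed
    then show ?thesis
      using base Grid.pair_finite_verts unfolding decomposition_width_def by (subst Max_le_iff) auto
  qed
  finally show ?thesis .
qed

theorem theorem4p3:
  fixes G :: "'a pair_pre_digraph"
  assumes "pair_graph G"
  shows "smw G = chromatic_number G"
proof (rule antisym)
  obtain c where "proper_colouring G (chromatic_number G) c"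
    using chromatic_number_attained[OF assms] by blast
  then show "smw G \<le> chromatic_number G" by (rule smw_le_colours[OF assms])
  obtain M :: "nat pair_pre_digraph" and X where
      "median_decomposition G M X" "Theta_smooth M X" "decomposition_width M X = smw G"
    using smw_attained[OF assms] by blast
  then show "chromatic_number G \<le> smw G"
    using chromatic_number_le_width[OF assms] by metis
qed

end
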